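(* Let $\Sigma$ be the Markov jump linear system $x(k+1)=A_{r(k)}x(k)+B_{r(k)}u(k)$, let $\mathcal T_{s,\Lambda}$ be the family of observation processes induced by the Markov chain $s$ and the set $\Lambda$, let $T$ be a positive integer, and let $\bar\Sigma$ be the extended Markov jump linear system with Markov-state space $\bar{\mathfrak X}=[N]\times[M]\times[N]\times[T]$ (all as defined in the context). Assume that the family $\{\bar K_\chi\}_{\chi\in\bar{\mathfrak X}}\subset\mathbb{R}^{m\times n}$ stabilizes $\bar\Sigma$ and satisfies $$\bar K_{\alpha,\beta,\gamma,\delta}=\bar K_{\alpha',\beta',\gamma,\delta}$$ for all $\alpha,\alpha'\in[N]$, $\beta,\beta'\in[M]$, $\gamma\in[N]$ and $\delta\in[T]$. For each $\gamma\in[N]$ and $\delta\in[T]$ define $K_{\gamma,\delta}=\bar K_{1,1,\gamma,\delta}$. Then $K=\{K_{\gamma,\delta}\}_{\gamma\in[N],\delta\in[T]}$ stabilizes $(\Sigma,\mathcal T_{s,\Lambda})$.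
   Context: Notation: $[N]=\{1,\dots,N\}$; $\mathbb N$ is the set of nonnegative integers; $n,m,N,M,T$ are positive integers. For an integer $k$, $\lfloor k\rfloor_T$ is the unique integer in $[T]$ such that $k-\lfloor k\rfloor_T$ is an integer multiple of $T$. $\mathbf 1(\cdot)$ equals $1$ if the condition holds and $0$ otherwise. $\|\cdot\|$ is the Euclidean norm. System: $A_1,\dots,A_N\in\mathbb{R}^{n\times n}$, $B_1,\dots,B_N\in\mathbb{R}^{n\times m}$; $r=\{r(k)\}_{k\ge0}$ is a time-homogeneous Markov chain on $[N]$ with transition probability matrix $P=[p_{ij}]$; the initial values $x(0)=x_0\in\mathbb{R}^n$ and $r(0)=r_0\in[N]$ are constants. Observations: $s$ is a time-homogeneous Markov chain on $[M]$ with transition probability matrix $Q=[q_{ij}]$, independent of $r$, and $\Lambda\subset[M]$ is a nonempty set recurrent for $s$, in the sense that from every initial state, with probability one $s(k)\in\Lambda$ for infinitely many $k$. For an initial state $s_0\in[M]$, $s(\cdot;s_0)$ is the chain $s$ started at $s_0$ and $t_\Lambda(s(\cdot;s_0))=\{t_i\}_{i\ge0}$ is the increasing enumeration of $\{k\in\mathbb N: s(k;s_0)\in\Lambda\}$. Put $\mathcal T_{s,\Lambda}=\{t_\Lambda(s(\cdot;s_0))\}_{s_0=1}^M$. For $t=\{t_i\}\in\mathcal T_{s,\Lambda}$, an integer $\tau_0<0$ and $\sigma_0\in[N]$, set $\tau(k)=\max\{t_i:t_i\le k\}$ and $\sigma(k)=r(\tau(k))$ if $k\ge\max(0,t_0)$,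 and $\tau(k)=\tau_0$, $\sigma(k)=\sigma_0$ otherwise. Stabilization of $(\Sigma,\mathcal T)$: given gains $K_{\gamma,\delta}\in\mathbb{R}^{m\times n}$, $\gamma\in[N]$, $\delta\in[T]$, the feedback $u(k)=K_{\sigma(k),\lfloor k+1-\tau(k)\rfloor_T}x(k)$ gives the closed loop $\Sigma_K$: $x(k+1)=(A_{r(k)}+B_{r(k)}K_{\sigma(k),\lfloor k+1-\tau(k)\rfloor_T})x(k)$. For a set $\mathcal T$ of observation processes, $K$ stabilizes $(\Sigma,\mathcal T)$ if there exist $C>0$ and $\epsilon\in[0,1)$ such that the solution of $\Sigma_K$ satisfies $E[\|x(k)\|^2]\le C\epsilon^k\|x_0\|^2$ for all $k\ge0$, $x_0\in\mathbb{R}^n$, $r_0\in[N]$, integers $\tau_0<0$, $\sigma_0\in[N]$ and $t\in\mathcal T$. Extended system: $\theta$ is the time-homogeneous Markov chain on $\bar{\mathfrak X}=[N]\times[M]\times[N]\times[T]$ whose transition probability from $\chi=(\alpha,\beta,\gamma,\delta)$ to $\chi'=(\alpha',\beta',\gamma',\delta')$ is $$\bar p_{\chi,\chi'}=\begin{cases}\mathbf 1(\alpha'=\gamma',\ \delta'=1)\,p_{\alpha,\alpha'}q_{\beta,\beta'} & \text{if }\beta'\in\Lambda,\\ \mathbf 1(\gamma'=\gamma,\ \delta'=\lfloor\delta+1\rfloor_T)\,p_{\alpha,\alpha'}q_{\beta,\beta'} & \text{if }\beta'\notin\Lambda.\end{cases}$$ For $\chi=(\alpha,\beta,\gamma,\delta)\in\bar{\mathfrak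 X}$ put $\bar A_\chi=A_\alpha$, $\bar B_\chi=B_\alpha$. The system $\bar\Sigma$ is $\bar x(k+1)=\bar A_{\theta(k)}\bar x(k)+\bar B_{\theta(k)}\bar u(k)$ with constant initial values $\bar x(0)=\bar x_0\in\mathbb{R}^n$, $\theta(0)=\theta_0\in\bar{\mathfrak X}$. A family $\{\bar K_\chi\}_{\chi\in\bar{\mathfrak X}}\subset\mathbb{R}^{m\times n}$ stabilizes $\bar\Sigma$ if there exist $C>0$ and $\epsilon\in[0,1)$ such that the solution of $\bar x(k+1)=(\bar A_{\theta(k)}+\bar B_{\theta(k)}\bar K_{\theta(k)})\bar x(k)$ satisfies $E[\|\bar x(k)\|^2]\le C\epsilon^k\|\bar x_0\|^2$ for all $k\ge0$, $\bar x_0\in\mathbb{R}^n$ and $\theta_0\in\bar{\mathfrak X}$. *)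

theory Defs
  imports "HOL-Probability.Probability"
begin

text \<open>The set \<open>[N]\<close> is \<open>{1..N}\<close>, and functions on \<open>[N]\<close> are functions on \<open>nat\<close> whose values
  outside \<open>{1..N}\<close> are never used. A random process is a function of time and sample point.\<close>

definition transition_matrix :: "'c set \<Rightarrow> ('c \<Rightarrow> 'c \<Rightarrow> real) \<Rightarrow> bool" where
  "transition_matrix S p \<longleftrightarrow>
     (\<forall>i\<in>S. \<forall>j\<in>S. 0 \<le> p i j) \<and> (\<forall>i\<in>S. (\<Sum>j\<in>S. p i j) = 1)"

text \<open>Used only for finite state spaces \<open>S\<close>.\<close>

definition markov_chain ::
    "'w measure \<Rightarrow> 'c set \<Rightarrow> ('c \<Rightarrow> 'c \<Rightarrow> real) \<Rightarrow> 'c \<Rightarrow> (nat \<Rightarrow> 'w \<Rightarrow> 'c) \<Rightarrow> bool" where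
  "markov_chain \<Omega> S p c0 X \<longleftrightarrow>
     transition_matrix S p \<and>
     (\<forall>k. X k \<in> measurable \<Omega> (count_space S)) \<and>
     (AE \<omega> in \<Omega>. X 0 \<omega> = c0) \<and>
     (\<forall>k c. (\<forall>i\<le>Suc k. c i \<in> S) \<longrightarrow> \<P>(\<omega> in \<Omega>. \<forall>i\<le>k. X i \<omega> = c i) > 0 \<longrightarrow>
        cond_prob \<Omega> (\<lambda>\<omega>. X (Suc k) \<omega> = c (Suc k)) (\<lambda>\<omega>. \<forall>i\<le>k. X i \<omega> = c i)
          = p (c k) (c (Suc k)))"

definition indep_processes ::
    "'w measure \<Rightarrow> 'c set \<Rightarrow> (nat \<Rightarrow> 'w \<Rightarrow> 'c) \<Rightarrow> 'c set \<Rightarrow> (nat \<Rightarrow> 'w \<Rightarrow> 'c) \<Rightarrow> bool" where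
  "indep_processes \<Omega> S X S' Y \<longleftrightarrow>
     prob_space.indep_var \<Omega>
       (PiM UNIV (\<lambda>k. count_space S)) (\<lambda>\<omega> k. X k \<omega>)
       (PiM UNIV (\<lambda>k. count_space S')) (\<lambda>\<omega> k. Y k \<omega>)"

text \<open>The representative of \<open>k\<close> modulo \<open>T\<close> in \<open>{1..T}\<close> (so multiples of \<open>T\<close> give \<open>T\<close>, not \<open>0\<close>).\<close>

definition cyc :: "nat \<Rightarrow> int \<Rightarrow> nat" where
  "cyc T k = (THE j. j \<in> {1..T} \<and> int T dvd k - int j)"

lemma cyc_eq:
  assumes "T > 0"
  shows "cyc T k = nat ((k - 1) mod int T) + 1"
  unfolding cyc_def
proof (rule the_equality)
  have b: "0 \<le> (k - 1) mod int T" "(k - 1) mod int T < int T"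
    using assms by auto
  have "k - int (nat ((k - 1) mod int T) + 1) = (k - 1) - (k - 1) mod int T"
    using b by simp
  then have "int T dvd k - int (nat ((k - 1) mod int T) + 1)"
    by (metis dvd_minus_mod)
  then show "nat ((k - 1) mod int T) + 1 \<in> {1..T} \<and>
      int T dvd k - int (nat ((k - 1) mod int T) + 1)"
    using b by auto
next
  fix j assume j: "j \<in> {1..T} \<and> int T dvd k - int j"
  then have "int T dvd (k - 1) - (int j - 1)" by simp
  then have "(k - 1) mod int T = (int j - 1) mod int T"
    by (simp add: mod_eq_dvd_iff)
  also have "\<dots> = int j - 1" using j by (intro mod_pos_pos_trivial) auto
  finally show "j = nat ((k - 1) mod int T) + 1" using j by auto
qed

primrec solution ::
    "(nat \<Rightarrow> 'w \<Rightarrow> real ^ 'n ^ 'n) \<Rightarrow> real ^ 'n \<Rightarrow> nat \<Rightarrow> 'w \<Rightarrow> real ^ 'n::finite" where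
  "solution F x0 0 \<omega> = x0"
| "solution F x0 (Suc k) \<omega> = F k \<omega> *v solution F x0 k \<omega>"

text \<open>Expectations of squared norms are taken in \<open>ennreal\<close>, so that a bound on them includes
  their finiteness.\<close>

definition second_moment :: "'w measure \<Rightarrow> ('w \<Rightarrow> real ^ 'n::finite) \<Rightarrow> ennreal" where
  "second_moment \<Omega> x = (\<integral>\<^sup>+ \<omega>. ennreal ((norm (x \<omega>))\<^sup>2) \<partial>\<Omega>)"

text \<open>In the definitions below a chain comes as a family indexed by its initial state: \<open>r r0 k\<close> is
  the state at time \<open>k\<close> of the chain started at \<open>r0\<close>. An observation process is a random sequence
  \<open>t :: nat \<Rightarrow> 'w \<Rightarrow> nat\<close> of times.\<close>

text \<open>On sample points where \<open>s s0\<close> visits \<open>\<Lambda>\<close> only finitely often the sequence is arbitrary from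
  some index on; for recurrent \<open>\<Lambda>\<close> these form a null set.\<close>

definition obs_process :: "nat set \<Rightarrow> (nat \<Rightarrow> 'w \<Rightarrow> nat) \<Rightarrow> nat \<Rightarrow> 'w \<Rightarrow> nat" where
  "obs_process \<Lambda> s i \<omega> = enumerate {k. s k \<omega> \<in> \<Lambda>} i"

definition obs_family ::
    "nat \<Rightarrow> nat set \<Rightarrow> (nat \<Rightarrow> nat \<Rightarrow> 'w \<Rightarrow> nat) \<Rightarrow> (nat \<Rightarrow> 'w \<Rightarrow> nat) set" where
  "obs_family M \<Lambda> s = {obs_process \<Lambda> (s s0) | s0. s0 \<in> {1..M}}"

definition recurrent_set :: "'w measure \<Rightarrow> nat \<Rightarrow> (nat \<Rightarrow> nat \<Rightarrow> 'w \<Rightarrow> nat) \<Rightarrow> nat set \<Rightarrow> bool" where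
  "recurrent_set \<Omega> M s \<Lambda> \<longleftrightarrow> (\<forall>s0\<in>{1..M}. AE \<omega> in \<Omega>. infinite {k. s s0 k \<omega> \<in> \<Lambda>})"

definition last_obs :: "(nat \<Rightarrow> 'w \<Rightarrow> nat) \<Rightarrow> nat \<Rightarrow> 'w \<Rightarrow> nat" where
  "last_obs t k \<omega> = Max {t i \<omega> | i. t i \<omega> \<le> k}"

text \<open>As \<open>t 0 \<omega>\<close> is a natural number, the condition \<open>k \<ge> max 0 (t 0 \<omega>)\<close> reads \<open>t 0 \<omega> \<le> k\<close>.\<close>

definition tau :: "(nat \<Rightarrow> 'w \<Rightarrow> nat) \<Rightarrow> int \<Rightarrow> nat \<Rightarrow> 'w \<Rightarrow> int" where
  "tau t \<tau>0 k \<omega> = (if t 0 \<omega> \<le> k then int (last_obs t k \<omega>) else \<tau>0)"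

definition sigma ::
    "(nat \<Rightarrow> 'w \<Rightarrow> nat) \<Rightarrow> (nat \<Rightarrow> 'w \<Rightarrow> nat) \<Rightarrow> nat \<Rightarrow> nat \<Rightarrow> 'w \<Rightarrow> nat" where
  "sigma r t \<sigma>0 k \<omega> = (if t 0 \<omega> \<le> k then r (last_obs t k \<omega>) \<omega> else \<sigma>0)"

definition closed_loop ::
    "(nat \<Rightarrow> real ^ 'n ^ 'n) \<Rightarrow> (nat \<Rightarrow> real ^ 'm ^ 'n) \<Rightarrow> (nat \<Rightarrow> 'w \<Rightarrow> nat) \<Rightarrow> nat \<Rightarrow>
     (nat \<Rightarrow> nat \<Rightarrow> real ^ 'n ^ 'm) \<Rightarrow> (nat \<Rightarrow> 'w \<Rightarrow> nat) \<Rightarrow> int \<Rightarrow> nat \<Rightarrow>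
     nat \<Rightarrow> 'w \<Rightarrow> real ^ 'n::finite ^ 'n" where
  "closed_loop A B r T K t \<tau>0 \<sigma>0 k \<omega> =
     A (r k \<omega>) + B (r k \<omega>) ** K (sigma r t \<sigma>0 k \<omega>) (cyc T (int k + 1 - tau t \<tau>0 k \<omega>))"

definition stabilizes_obs ::
    "'w measure \<Rightarrow> nat \<Rightarrow> (nat \<Rightarrow> real ^ 'n::finite ^ 'n) \<Rightarrow> (nat \<Rightarrow> real ^ 'm::finite ^ 'n) \<Rightarrow>
     (nat \<Rightarrow> nat \<Rightarrow> 'w \<Rightarrow> nat) \<Rightarrow> (nat \<Rightarrow> 'w \<Rightarrow> nat) set \<Rightarrow> nat \<Rightarrow>
     (nat \<Rightarrow> nat \<Rightarrow> real ^ 'n ^ 'm) \<Rightarrow> bool" where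
  "stabilizes_obs \<Omega> N A B r \<T> T K \<longleftrightarrow>
     (\<exists>C \<epsilon>. C > 0 \<and> 0 \<le> \<epsilon> \<and> \<epsilon> < 1 \<and>
       (\<forall>k x0. \<forall>r0\<in>{1..N}. \<forall>\<tau>0<0. \<forall>\<sigma>0\<in>{1..N}. \<forall>t\<in>\<T>.
          second_moment \<Omega> (solution (closed_loop A B (r r0) T K t \<tau>0 \<sigma>0) x0 k)
            \<le> ennreal (C * \<epsilon> ^ k * (norm x0)\<^sup>2)))"

definition stabilizes_mjls ::
    "'w measure \<Rightarrow> 'c set \<Rightarrow> ('c \<Rightarrow> real ^ 'n::finite ^ 'n) \<Rightarrow> ('c \<Rightarrow> real ^ 'm::finite ^ 'n) \<Rightarrow>
     ('c \<Rightarrow> nat \<Rightarrow> 'w \<Rightarrow> 'c) \<Rightarrow> ('c \<Rightarrow> real ^ 'n ^ 'm) \<Rightarrow> bool" where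
  "stabilizes_mjls \<Omega> S A B \<theta> K \<longleftrightarrow>
     (\<exists>C \<epsilon>. C > 0 \<and> 0 \<le> \<epsilon> \<and> \<epsilon> < 1 \<and>
       (\<forall>k x0. \<forall>\<theta>0\<in>S.
          second_moment \<Omega>
            (solution (\<lambda>k \<omega>. A (\<theta> \<theta>0 k \<omega>) + B (\<theta> \<theta>0 k \<omega>) ** K (\<theta> \<theta>0 k \<omega>)) x0 k)
            \<le> ennreal (C * \<epsilon> ^ k * (norm x0)\<^sup>2)))"

type_synonym ext_state = "nat \<times> nat \<times> nat \<times> nat"

definition ext_states :: "nat \<Rightarrow> nat \<Rightarrow> nat \<Rightarrow> ext_state set" where
  "ext_states N M T = {1..N} \<times> {1..M} \<times> {1..N} \<times> {1..T}"

fun ext_prob ::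
    "nat \<Rightarrow> nat set \<Rightarrow> (nat \<Rightarrow> nat \<Rightarrow> real) \<Rightarrow> (nat \<Rightarrow> nat \<Rightarrow> real) \<Rightarrow>
     ext_state \<Rightarrow> ext_state \<Rightarrow> real" where
  "ext_prob T \<Lambda> p q (\<alpha>, \<beta>, \<gamma>, \<delta>) (\<alpha>', \<beta>', \<gamma>', \<delta>') =
     (if \<beta>' \<in> \<Lambda>
      then of_bool (\<alpha>' = \<gamma>' \<and> \<delta>' = 1) * p \<alpha> \<alpha>' * q \<beta> \<beta>'
      else of_bool (\<gamma>' = \<gamma> \<and> \<delta>' = cyc T (int \<delta> + 1)) * p \<alpha> \<alpha>' * q \<beta> \<beta>')"

end

theory Submission
  imports Defs
begin

text \<open>The closed loop with observations is the extended closed loop in disguise. Along the paths of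
  \<open>r\<close> and \<open>s\<close>, the last observed mode \<open>sigma\<close> and the residue of the time elapsed since the last
  observation obey a deterministic recursion driven by the new values of \<open>r\<close> and \<open>s\<close>
  (\<open>ext_step\<close>): an observation resets them, and otherwise the mode is kept and the residue is
  incremented. Hence the quadruple consisting of \<open>r\<close>, \<open>s\<close>, \<open>sigma\<close> and the residue is almost surely
  the process \<open>ext_process\<close> (lemma \<open>ext_process_eq\<close>). The prescribed initial data \<open>\<tau>0\<close> and \<open>\<sigma>0\<close>
  enter only through its initial state, which takes finitely many values, all covered by the
  stability of the extended system; this is why the bound is uniform in them.

  The rest is a comparison of laws. By independence of \<open>r\<close> and \<open>s\<close>, a finite path of
  \<open>ext_process\<close> has as its probability the product of the transition probabilities \<open>ext_prob\<close>
  (lemma \<open>ext_process_path_prob\<close>), which is also its probability under the extended chain started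
  at the same state (lemma \<open>markov_chain_path_prob\<close>). As the state spaces are finite, the second
  moment of the solution at time \<open>k\<close> is a finite sum over paths weighted by these probabilities
  (lemma \<open>second_moment_sum_paths\<close>). So the second moments of the two closed loops coincide, since
  a gain that depends only on \<open>\<gamma>\<close> and \<open>\<delta>\<close> is the same matrix in both, and the constants \<open>C\<close> and
  \<open>\<epsilon>\<close> carry over.\<close>

section \<open>Path probabilities and second moments\<close>

lemma path_event_measurable:
  fixes k :: nat
  assumes X: "\<And>i. X i \<in> measurable \<Omega> (count_space S)" and c: "\<forall>i\<le>k. c i \<in> S"
  shows "{\<omega> \<in> space \<Omega>. \<forall>i\<le>k. X i \<omega> = c i} \<in> sets \<Omega>"
proof -
  have "{\<omega> \<in> space \<Omega>. \<forall>i\<le>k. X i \<omega> = c i} = (\<Inter>i\<in>{..k}. X i -` {c i} \<inter> space \<Omega>)"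
    by auto
  also have "\<dots> \<in> sets \<Omega>"
  proof (rule sets.finite_INT)
    fix i assume "i \<in> {..k}"
    then have "{c i} \<in> sets (count_space S)" using c by simp
    then show "X i -` {c i} \<inter> space \<Omega> \<in> sets \<Omega>" by (rule measurable_sets[OF X])
  qed auto
  finally show ?thesis .
qed

text \<open>Conditioning on a prefix of probability zero says nothing about the next step, but then the
  longer path and the product vanish as well.\<close>

lemma markov_chain_path_prob:
  assumes "prob_space \<Omega>" and chain: "markov_chain \<Omega> S p c0 X" and "\<forall>i\<le>k. c i \<in> S"
  shows "\<P>(\<omega> in \<Omega>. \<forall>i\<le>k. X i \<omega> = c i)
    = of_bool (c 0 = c0) * (\<Prod>i<k. p (c i) (c (Suc i)))"
  using assms(3)
proof (induction k)
  case 0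
  interpret prob_space \<Omega> by fact
  have init: "AE \<omega> in \<Omega>. X 0 \<omega> = c0"
    and X: "\<And>i. X i \<in> measurable \<Omega> (count_space S)"
    using chain by (auto simp: markov_chain_def)
  have "\<P>(\<omega> in \<Omega>. X 0 \<omega> = c 0) = \<P>(\<omega> in \<Omega>. c0 = c 0)"
  proof (rule prob_eq_AE)
    show "{\<omega> \<in> space \<Omega>. X 0 \<omega> = c 0} \<in> events"
      using path_event_measurable[where k=0, OF X 0] by simp
  qed (use init in auto)
  also have "\<dots> = of_bool (c 0 = c0)"
    by (cases "c0 = c 0") (auto simp: prob_space)
  finally show ?case by simp
next
  case (Suc k)
  interpret prob_space \<Omega> by fact
  let ?pre = "\<P>(\<omega> in \<Omega>. \<forall>i\<le>k. X i \<omega> = c i)"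
  let ?step = "p (c k) (c (Suc k))"
  have IH: "?pre = of_bool (c 0 = c0) * (\<Prod>i<k. p (c i) (c (Suc i)))"
    using Suc by simp
  have split: "(\<forall>i\<le>Suc k. X i \<omega> = c i) \<longleftrightarrow> X (Suc k) \<omega> = c (Suc k) \<and> (\<forall>i\<le>k. X i \<omega> = c i)" for \<omega>
    by (auto simp: le_Suc_eq)
  have meas: "{\<omega> \<in> space \<Omega>. \<forall>i\<le>k. X i \<omega> = c i} \<in> events"
    by (rule path_event_measurable[where S=S])
      (use chain Suc.prems in \<open>auto simp: markov_chain_def\<close>)
  have "\<P>(\<omega> in \<Omega>. \<forall>i\<le>Suc k. X i \<omega> = c i) = ?pre * ?step"
  proof (cases "?pre > 0")
    case True
    then have "cond_prob \<Omega> (\<lambda>\<omega>. X (Suc k) \<omega> = c (Suc k)) (\<lambda>\<omega>. \<forall>i\<le>k. X i \<omega> = c i) = ?step"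
      using chain Suc.prems unfolding markov_chain_def by blast
    then show ?thesis
      using True unfolding cond_prob_def split by (simp add: field_simps)
  next
    case False
    then have "?pre = 0" by (simp add: zero_less_measure_iff)
    moreover have "\<P>(\<omega> in \<Omega>. \<forall>i\<le>Suc k. X i \<omega> = c i) \<le> ?pre"
      unfolding split by (rule finite_measure_mono[OF _ meas]) blast
    ultimately show ?thesis by (simp add: measure_le_0_iff)
  qed
  then show ?case using IH by simp
qed

lemma solution_cong:
  assumes "\<And>j. j < k \<Longrightarrow> F j \<omega> = F' j \<omega>'"
  shows "solution F x0 k \<omega> = solution F' x0 k \<omega>'"
  using assms
proof (induction k)
  case (Suc k)
  have "solution F x0 k \<omega> = solution F' x0 k \<omega>'"
    by (rule Suc.IH) (rule Suc.prems, simp)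
  then show ?case
    using Suc.prems[OF lessI] by (simp only: solution.simps)
qed simp

text \<open>The solution at time \<open>k\<close> is a function of the path up to time \<open>k\<close>; on the right-hand side
  \<open>solution\<close> is run with a path as the sample point.\<close>

lemma second_moment_sum_paths:
  assumes "finite S" and X: "\<And>i. X i \<in> measurable \<Omega> (count_space S)"
  shows "second_moment \<Omega> (solution (\<lambda>k \<omega>. G (X k \<omega>)) x0 k)
    = (\<Sum>c\<in>PiE {..k} (\<lambda>_. S).
        ennreal ((norm (solution (\<lambda>k c. G (c k)) x0 k c))\<^sup>2)
          * emeasure \<Omega> {\<omega> \<in> space \<Omega>. \<forall>i\<le>k. X i \<omega> = c i})"
proof -
  let ?P = "PiE {..k} (\<lambda>_. S)"
  let ?f = "\<lambda>c. ennreal ((norm (solution (\<lambda>k c. G (c k)) x0 k c))\<^sup>2)"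
  let ?C = "\<lambda>c. {\<omega> \<in> space \<Omega>. \<forall>i\<le>k. X i \<omega> = c i}"
  have fin: "finite ?P" using assms(1) by (intro finite_PiE) auto
  have meas: "?C c \<in> sets \<Omega>" if "c \<in> ?P" for c
    by (rule path_event_measurable[OF X]) (use that in auto)
  have pt: "ennreal ((norm (solution (\<lambda>k \<omega>. G (X k \<omega>)) x0 k \<omega>))\<^sup>2)
      = (\<Sum>c\<in>?P. ?f c * indicator (?C c) \<omega>)" if "\<omega> \<in> space \<Omega>" for \<omega>
  proof -
    let ?c = "restrict (\<lambda>i. X i \<omega>) {..k}"
    have mem: "?c \<in> ?P"
      using measurable_space[OF X that] by auto
    have uniq: "c = ?c" if "c \<in> ?P" "\<omega> \<in> ?C c" for c
      by (rule PiE_ext[OF that(1) mem]) (use that(2) in simp)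
    have "(\<Sum>c\<in>?P. ?f c * indicator (?C c) \<omega>) = (\<Sum>c\<in>?P. if c = ?c then ?f c else 0)"
    proof (intro sum.cong refl)
      fix c assume "c \<in> ?P"
      show "?f c * indicator (?C c) \<omega> = (if c = ?c then ?f c else 0)"
      proof (cases "c = ?c")
        case True
        have "\<omega> \<in> ?C ?c" using \<open>\<omega> \<in> space \<Omega>\<close> by simp
        then have "\<omega> \<in> ?C c" unfolding True[symmetric] .
        then have "indicator (?C c) \<omega> = (1::ennreal)" by (rule indicator_simps)
        then show ?thesis using True by (simp only: if_True mult_1_right simp_thms)
      next
        case False
        then have "\<omega> \<notin> ?C c" using uniq[OF \<open>c \<in> ?P\<close>] by blast
        then have "indicator (?C c) \<omega> = (0::ennreal)" by (rule indicator_simps)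
        then show ?thesis using False by (simp only: if_False mult_zero_right simp_thms)
      qed
    qed
    also have "\<dots> = ?f ?c" using fin mem by simp
    also have "solution (\<lambda>k c. G (c k)) x0 k ?c = solution (\<lambda>k \<omega>. G (X k \<omega>)) x0 k \<omega>"
      by (rule solution_cong) auto
    finally show ?thesis by simp
  qed
  have "second_moment \<Omega> (solution (\<lambda>k \<omega>. G (X k \<omega>)) x0 k)
      = (\<integral>\<^sup>+\<omega>. (\<Sum>c\<in>?P. ?f c * indicator (?C c) \<omega>) \<partial>\<Omega>)"
    unfolding second_moment_def by (intro nn_integral_cong pt)
  also have "\<dots> = (\<Sum>c\<in>?P. \<integral>\<^sup>+\<omega>. ?f c * indicator (?C c) \<omega> \<partial>\<Omega>)"
    by (intro nn_integral_sum borel_measurable_times_ennreal borel_measurable_indicator meas) simp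
  also have "\<dots> = (\<Sum>c\<in>?P. ?f c * emeasure \<Omega> (?C c))"
    by (intro sum.cong refl nn_integral_cmult_indicator meas)
  finally show ?thesis .
qed

section \<open>The extended process built from the two chains\<close>

definition ext_step :: "nat \<Rightarrow> nat set \<Rightarrow> ext_state \<Rightarrow> nat \<Rightarrow> nat \<Rightarrow> ext_state" where
  "ext_step T \<Lambda> \<xi> \<alpha>' \<beta>' = (case \<xi> of (\<alpha>, \<beta>, \<gamma>, \<delta>) \<Rightarrow>
     (if \<beta>' \<in> \<Lambda> then (\<alpha>', \<beta>', \<alpha>', 1) else (\<alpha>', \<beta>', \<gamma>, cyc T (int \<delta> + 1))))"

text \<open>If the chain \<open>s\<close> starts in \<open>\<Lambda>\<close>, then time \<open>0\<close> is an observation time and the initial data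
  \<open>\<tau>0\<close> and \<open>\<sigma>0\<close> are never seen.\<close>

definition ext_init :: "nat \<Rightarrow> nat set \<Rightarrow> nat \<Rightarrow> nat \<Rightarrow> int \<Rightarrow> nat \<Rightarrow> ext_state" where
  "ext_init T \<Lambda> r0 s0 \<tau>0 \<sigma>0 =
     (if s0 \<in> \<Lambda> then (r0, s0, r0, 1) else (r0, s0, \<sigma>0, cyc T (1 - \<tau>0)))"

text \<open>The initial state is a constant, although \<open>r\<close> and \<open>s\<close> need to start at \<open>\<xi>0\<close> only almost
  surely. Thus a path that violates the recursion has an empty event, and not merely a null
  event.\<close>

primrec ext_process ::
    "nat \<Rightarrow> nat set \<Rightarrow> ext_state \<Rightarrow> (nat \<Rightarrow> 'w \<Rightarrow> nat) \<Rightarrow> (nat \<Rightarrow> 'w \<Rightarrow> nat) \<Rightarrow>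
      nat \<Rightarrow> 'w \<Rightarrow> ext_state" where
  "ext_process T \<Lambda> \<xi>0 r s 0 \<omega> = \<xi>0"
| "ext_process T \<Lambda> \<xi>0 r s (Suc k) \<omega> =
     ext_step T \<Lambda> (ext_process T \<Lambda> \<xi>0 r s k \<omega>) (r (Suc k) \<omega>) (s (Suc k) \<omega>)"

lemma ext_step_fst [simp]:
  "fst (ext_step T \<Lambda> \<xi> a b) = a" "fst (snd (ext_step T \<Lambda> \<xi> a b)) = b"
  by (auto simp: ext_step_def split: prod.split)

lemma cyc_mem: "T > 0 \<Longrightarrow> cyc T k \<in> {1..T}"
  by (auto simp: cyc_eq nat_less_iff Suc_le_eq)

lemma cyc_1: "T > 0 \<Longrightarrow> cyc T 1 = 1"
  by (simp add: cyc_eq)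

lemma cyc_cyc_add_1: "T > 0 \<Longrightarrow> cyc T (int (cyc T k) + 1) = cyc T (k + 1)"
  by (simp add: cyc_eq mod_simps)

lemma ext_step_mem:
  assumes "T > 0" "\<xi> \<in> ext_states N M T" "a \<in> {1..N}" "b \<in> {1..M}"
  shows "ext_step T \<Lambda> \<xi> a b \<in> ext_states N M T"
  using assms cyc_mem[OF assms(1)]
  by (cases \<xi>) (simp add: ext_step_def ext_states_def)

lemma ext_init_mem:
  assumes "T > 0" "r0 \<in> {1..N}" "s0 \<in> {1..M}" "\<sigma>0 \<in> {1..N}"
  shows "ext_init T \<Lambda> r0 s0 \<tau>0 \<sigma>0 \<in> ext_states N M T"
  using assms cyc_mem[OF assms(1)] by (simp add: ext_init_def ext_states_def)

lemma ext_prob_eq_step: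
  "ext_prob T \<Lambda> p q \<xi> \<xi>' =
     of_bool (\<xi>' = ext_step T \<Lambda> \<xi> (fst \<xi>') (fst (snd \<xi>')))
       * (p (fst \<xi>) (fst \<xi>') * q (fst (snd \<xi>)) (fst (snd \<xi>')))"
  by (cases \<xi>; cases \<xi>') (auto simp: ext_step_def)

lemma finite_ext_states: "finite (ext_states N M T)"
  by (simp add: ext_states_def)

lemma ext_process_measurable:
  assumes "T > 0" "\<xi>0 \<in> ext_states N M T"
    and r: "\<And>k. r k \<in> measurable \<Omega> (count_space {1..N})"
    and s: "\<And>k. s k \<in> measurable \<Omega> (count_space {1..M})"
  shows "ext_process T \<Lambda> \<xi>0 r s k \<in> measurable \<Omega> (count_space (ext_states N M T))"
proof (induction k)
  case 0
  then show ?case using assms(2) by simp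
next
  case (Suc k)
  let ?S = "ext_states N M T"
  have "(\<lambda>\<omega>. (ext_process T \<Lambda> \<xi>0 r s k \<omega>, r (Suc k) \<omega>, s (Suc k) \<omega>))
      \<in> measurable \<Omega> (count_space ?S \<Otimes>\<^sub>M (count_space {1..N} \<Otimes>\<^sub>M count_space {1..M}))"
    by (intro measurable_Pair Suc r s)
  then have state: "(\<lambda>\<omega>. (ext_process T \<Lambda> \<xi>0 r s k \<omega>, r (Suc k) \<omega>, s (Suc k) \<omega>))
      \<in> measurable \<Omega> (count_space (?S \<times> {1..N} \<times> {1..M}))"
    by (simp add: pair_measure_count_space finite_ext_states)
  have step: "(\<lambda>(\<xi>, a, b). ext_step T \<Lambda> \<xi> a b)
      \<in> measurable (count_space (?S \<times> {1..N} \<times> {1..M})) (count_space ?S)"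
    using ext_step_mem[OF assms(1)] by auto
  show ?case
    using measurable_compose[OF state step] by simp
qed

text \<open>The first two components of a path determine the other two. So the path has an empty event,
  or its event is, up to a null set, the intersection of a path event of \<open>r\<close> and one of \<open>s\<close>, whose
  probability factorizes by independence.\<close>

lemma ext_process_path_prob:
  assumes "prob_space \<Omega>" "T > 0" "\<xi>0 \<in> ext_states N M T"
    and r: "markov_chain \<Omega> {1..N} p (fst \<xi>0) r"
    and s: "markov_chain \<Omega> {1..M} q (fst (snd \<xi>0)) s"
    and indep: "indep_processes \<Omega> {1..N} r {1..M} s"
    and c: "\<forall>i\<le>k. c i \<in> ext_states N M T"
  shows "\<P>(\<omega> in \<Omega>. \<forall>i\<le>k. ext_process T \<Lambda> \<xi>0 r s i \<omega> = c i)
    = of_bool (c 0 = \<xi>0) * (\<Prod>i<k. ext_prob T \<Lambda> p q (c i) (c (Suc i)))"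
proof -
  interpret prob_space \<Omega> by fact
  define a where "a i = fst (c i)" for i
  define b where "b i = fst (snd (c i))" for i
  let ?Y = "ext_process T \<Lambda> \<xi>0 r s"
  let ?Pr = "PiM UNIV (\<lambda>_::nat. count_space {1..N})"
  let ?Ps = "PiM UNIV (\<lambda>_::nat. count_space {1..M})"
  have rm: "\<And>i. r i \<in> measurable \<Omega> (count_space {1..N})"
    and sm: "\<And>i. s i \<in> measurable \<Omega> (count_space {1..M})"
    and r0: "AE \<omega> in \<Omega>. r 0 \<omega> = fst \<xi>0" and s0: "AE \<omega> in \<Omega>. s 0 \<omega> = fst (snd \<xi>0)"
    using r s by (auto simp: markov_chain_def)
  have a_mem: "\<forall>i\<le>k. a i \<in> {1..N}" and b_mem: "\<forall>i\<le>k. b i \<in> {1..M}"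
    using c by (auto simp: a_def b_def ext_states_def)
  have cyl: "{f \<in> space (PiM UNIV (\<lambda>_::nat. count_space S)). \<forall>i\<le>k. f i = d i}
      \<in> sets (PiM UNIV (\<lambda>_::nat. count_space S))"
    if "\<forall>i\<le>k. d i \<in> S" for d :: "nat \<Rightarrow> nat" and S
    by (rule path_event_measurable[where X="\<lambda>i f. f i", OF _ that]) simp
  show ?thesis
  proof (cases "c 0 = \<xi>0 \<and> (\<forall>i<k. c (Suc i) = ext_step T \<Lambda> (c i) (a (Suc i)) (b (Suc i)))")
    case True
    have iff: "(\<forall>i\<le>k. ?Y i \<omega> = c i) \<longleftrightarrow> (\<forall>i\<le>k. r i \<omega> = a i) \<and> (\<forall>i\<le>k. s i \<omega> = b i)"
      if "r 0 \<omega> = fst \<xi>0" "s 0 \<omega> = fst (snd \<xi>0)" for \<omega>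
    proof
      assume Y: "\<forall>i\<le>k. ?Y i \<omega> = c i"
      have "r i \<omega> = fst (?Y i \<omega>) \<and> s i \<omega> = fst (snd (?Y i \<omega>))" for i
        using that by (cases i) auto
      then show "(\<forall>i\<le>k. r i \<omega> = a i) \<and> (\<forall>i\<le>k. s i \<omega> = b i)"
        using Y by (auto simp: a_def b_def)
    next
      assume rs: "(\<forall>i\<le>k. r i \<omega> = a i) \<and> (\<forall>i\<le>k. s i \<omega> = b i)"
      have "?Y i \<omega> = c i" if "i \<le> k" for i
        using that by (induction i) (use True rs in auto)
      then show "\<forall>i\<le>k. ?Y i \<omega> = c i" by blast
    qed
    have rY: "{\<omega> \<in> space \<Omega>. \<forall>i\<le>k. ?Y i \<omega> = c i} \<in> events"
      by (rule path_event_measurable[OF ext_process_measurable[OF assms(2,3) rm sm] c])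
    have rE: "{\<omega> \<in> space \<Omega>. \<forall>i\<le>k. r i \<omega> = a i} \<in> events"
      and sE: "{\<omega> \<in> space \<Omega>. \<forall>i\<le>k. s i \<omega> = b i} \<in> events"
      using path_event_measurable[OF rm a_mem] path_event_measurable[OF sm b_mem] .
    have "\<P>(\<omega> in \<Omega>. \<forall>i\<le>k. ?Y i \<omega> = c i)
        = \<P>(\<omega> in \<Omega>. (\<forall>i\<le>k. r i \<omega> = a i) \<and> (\<forall>i\<le>k. s i \<omega> = b i))"
    proof (rule prob_eq_AE)
      show "AE \<omega> in \<Omega>. (\<forall>i\<le>k. ?Y i \<omega> = c i) \<longleftrightarrow> (\<forall>i\<le>k. r i \<omega> = a i) \<and> (\<forall>i\<le>k. s i \<omega> = b i)"
        using r0 s0 by eventually_elim (rule iff)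
    next
      have "{\<omega> \<in> space \<Omega>. (\<forall>i\<le>k. r i \<omega> = a i) \<and> (\<forall>i\<le>k. s i \<omega> = b i)}
          = {\<omega> \<in> space \<Omega>. \<forall>i\<le>k. r i \<omega> = a i} \<inter> {\<omega> \<in> space \<Omega>. \<forall>i\<le>k. s i \<omega> = b i}"
        by blast
      then show "{\<omega> \<in> space \<Omega>. (\<forall>i\<le>k. r i \<omega> = a i) \<and> (\<forall>i\<le>k. s i \<omega> = b i)} \<in> events"
        using sets.Int[OF rE sE] by (simp only:)
    qed (rule rY)
    also have "\<dots> = \<P>(\<omega> in \<Omega>. \<forall>i\<le>k. r i \<omega> = a i) * \<P>(\<omega> in \<Omega>. \<forall>i\<le>k. s i \<omega> = b i)"
    proof -
      have sp: "(\<lambda>i. r i \<omega>) \<in> space ?Pr" "(\<lambda>i. s i \<omega>) \<in> space ?Ps" if "\<omega> \<in> space \<Omega>" for \<omega>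
        using measurable_space[OF rm that] measurable_space[OF sm that]
        by (auto simp: space_PiM)
      let ?A = "{f \<in> space ?Pr. \<forall>i\<le>k. f i = a i}"
      let ?B = "{f \<in> space ?Ps. \<forall>i\<le>k. f i = b i}"
      have "prob ((\<lambda>\<omega>. (\<lambda>i. r i \<omega>, \<lambda>i. s i \<omega>)) -` (?A \<times> ?B) \<inter> space \<Omega>)
          = prob ((\<lambda>\<omega> i. r i \<omega>) -` ?A \<inter> space \<Omega>) * prob ((\<lambda>\<omega> i. s i \<omega>) -` ?B \<inter> space \<Omega>)"
        using indep unfolding indep_processes_def
        by (rule indep_varD) (use cyl a_mem b_mem in auto)
      moreover have "(\<lambda>\<omega>. (\<lambda>i. r i \<omega>, \<lambda>i. s i \<omega>)) -` (?A \<times> ?B) \<inter> space \<Omega>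
          = {\<omega> \<in> space \<Omega>. (\<forall>i\<le>k. r i \<omega> = a i) \<and> (\<forall>i\<le>k. s i \<omega> = b i)}"
        and "(\<lambda>\<omega> i. r i \<omega>) -` ?A \<inter> space \<Omega> = {\<omega> \<in> space \<Omega>. \<forall>i\<le>k. r i \<omega> = a i}"
        and "(\<lambda>\<omega> i. s i \<omega>) -` ?B \<inter> space \<Omega> = {\<omega> \<in> space \<Omega>. \<forall>i\<le>k. s i \<omega> = b i}"
        using sp by blast+
      ultimately show ?thesis by simp
    qed
    also have "\<dots> = (\<Prod>i<k. p (a i) (a (Suc i))) * (\<Prod>i<k. q (b i) (b (Suc i)))"
      using markov_chain_path_prob[OF assms(1) r a_mem]
        markov_chain_path_prob[OF assms(1) s b_mem] conjunct1[OF True]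
      by (simp add: a_def b_def)
    also have "\<dots> = (\<Prod>i<k. ext_prob T \<Lambda> p q (c i) (c (Suc i)))"
      unfolding prod.distrib[symmetric]
    proof (intro prod.cong refl)
      fix i assume "i \<in> {..<k}"
      then have "c (Suc i) = ext_step T \<Lambda> (c i) (fst (c (Suc i))) (fst (snd (c (Suc i))))"
        using True by (auto simp only: a_def b_def lessThan_iff)
      then show "p (a i) (a (Suc i)) * q (b i) (b (Suc i)) = ext_prob T \<Lambda> p q (c i) (c (Suc i))"
        unfolding ext_prob_eq_step a_def b_def by (simp only: of_bool_eq simp_thms mult_1_left)
    qed
    finally show ?thesis using conjunct1[OF True] by simp
  next
    case False
    have "(c 0 = \<xi>0 \<and> (\<forall>i<k. c (Suc i) = ext_step T \<Lambda> (c i) (a (Suc i)) (b (Suc i))))"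
      if Y: "\<forall>i\<le>k. ?Y i \<omega> = c i" for \<omega>
    proof (intro conjI allI impI)
      show "c 0 = \<xi>0" using Y[rule_format, of 0] by simp
      fix i assume "i < k"
      then have "c (Suc i) = ext_step T \<Lambda> (c i) (r (Suc i) \<omega>) (s (Suc i) \<omega>)"
        using Y[rule_format, of "Suc i"] Y[rule_format, of i] by simp
      then show "c (Suc i) = ext_step T \<Lambda> (c i) (a (Suc i)) (b (Suc i))"
        by (simp add: a_def b_def)
    qed
    then have empty: "{\<omega> \<in> space \<Omega>. \<forall>i\<le>k. ?Y i \<omega> = c i} = {}"
      using False by blast
    have "c 0 \<noteq> \<xi>0 \<or> (\<exists>i<k. ext_prob T \<Lambda> p q (c i) (c (Suc i)) = 0)"
      using False by (auto simp: ext_prob_eq_step a_def b_def)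
    then have "of_bool (c 0 = \<xi>0) * (\<Prod>i<k. ext_prob T \<Lambda> p q (c i) (c (Suc i))) = 0"
      by auto
    then show ?thesis unfolding empty by simp
  qed
qed

section \<open>Identification with the observed mode and its age\<close>

lemma obs_process_range:
  assumes "infinite {k. s k \<omega> \<in> \<Lambda>}"
  shows "{obs_process \<Lambda> s i \<omega> | i. obs_process \<Lambda> s i \<omega> \<le> k} = {v. s v \<omega> \<in> \<Lambda> \<and> v \<le> k}"
proof -
  let ?V = "{k. s k \<omega> \<in> \<Lambda>}"
  have "{obs_process \<Lambda> s i \<omega> | i. obs_process \<Lambda> s i \<omega> \<le> k} = range (enumerate ?V) \<inter> {..k}"
    by (auto simp: obs_process_def)
  also have "\<dots> = {v. s v \<omega> \<in> \<Lambda> \<and> v \<le> k}"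
    unfolding range_enumerate[OF assms] by auto
  finally show ?thesis .
qed

lemma obs_process_0_le_iff:
  assumes "infinite {k. s k \<omega> \<in> \<Lambda>}"
  shows "obs_process \<Lambda> s 0 \<omega> \<le> k \<longleftrightarrow> (\<exists>v\<le>k. s v \<omega> \<in> \<Lambda>)"
proof
  assume "obs_process \<Lambda> s 0 \<omega> \<le> k"
  then show "\<exists>v\<le>k. s v \<omega> \<in> \<Lambda>"
    using enumerate_in_set[OF assms, of 0] by (auto simp: obs_process_def)
next
  assume "\<exists>v\<le>k. s v \<omega> \<in> \<Lambda>"
  then show "obs_process \<Lambda> s 0 \<omega> \<le> k"
    unfolding obs_process_def enumerate_0 by (metis Least_le le_trans mem_Collect_eq)
qed

text \<open>Recurrence is what makes the enumeration of the observation times a genuine one, so that its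
  values up to time \<open>k\<close> are exactly the visits of \<open>s\<close> to \<open>\<Lambda>\<close> up to time \<open>k\<close>.\<close>

lemma ext_process_eq:
  assumes "T > 0" and inf: "infinite {k. s k \<omega> \<in> \<Lambda>}"
    and init: "r 0 \<omega> = r0" "s 0 \<omega> = s0"
  defines "t \<equiv> obs_process \<Lambda> s"
  shows "ext_process T \<Lambda> (ext_init T \<Lambda> r0 s0 \<tau>0 \<sigma>0) r s k \<omega>
    = (r k \<omega>, s k \<omega>, sigma r t \<sigma>0 k \<omega>, cyc T (int k + 1 - tau t \<tau>0 k \<omega>))"
proof -
  have last: "last_obs t k \<omega> = Max {v. s v \<omega> \<in> \<Lambda> \<and> v \<le> k}" for k
    unfolding last_obs_def t_def obs_process_range[where s=s and \<Lambda>=\<Lambda> and \<omega>=\<omega>, OF inf] ..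
  have le: "t 0 \<omega> \<le> k \<longleftrightarrow> (\<exists>v\<le>k. s v \<omega> \<in> \<Lambda>)" for k
    unfolding t_def by (rule obs_process_0_le_iff[where s=s and \<Lambda>=\<Lambda> and \<omega>=\<omega>, OF inf])
  have obs: "tau t \<tau>0 k \<omega> = int k \<and> sigma r t \<sigma>0 k \<omega> = r k \<omega>" if "s k \<omega> \<in> \<Lambda>" for k
  proof -
    have "finite {v. s v \<omega> \<in> \<Lambda> \<and> v \<le> k}" by (rule finite_subset[of _ "{..k}"]) auto
    then have "Max {v. s v \<omega> \<in> \<Lambda> \<and> v \<le> k} = k"
      by (rule Max_eqI) (use that in auto)
    moreover have "t 0 \<omega> \<le> k" using that le by blast
    ultimately show ?thesis by (simp add: tau_def sigma_def last)
  qed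
  have no_obs: "tau t \<tau>0 (Suc k) \<omega> = tau t \<tau>0 k \<omega> \<and> sigma r t \<sigma>0 (Suc k) \<omega> = sigma r t \<sigma>0 k \<omega>"
    if "s (Suc k) \<omega> \<notin> \<Lambda>" for k
  proof -
    have "{v. s v \<omega> \<in> \<Lambda> \<and> v \<le> Suc k} = {v. s v \<omega> \<in> \<Lambda> \<and> v \<le> k}"
      using that by (auto simp: le_Suc_eq)
    moreover have "t 0 \<omega> \<le> Suc k \<longleftrightarrow> t 0 \<omega> \<le> k"
      using that unfolding le by (auto simp: le_Suc_eq)
    ultimately show ?thesis by (simp add: tau_def sigma_def last)
  qed
  show ?thesis
  proof (induction k)
    case 0
    show ?case
    proof (cases "s0 \<in> \<Lambda>")
      case True
      then show ?thesis using obs[of 0] init cyc_1[OF assms(1)] by (simp add: ext_init_def)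
    next
      case False
      then have "\<not> t 0 \<omega> \<le> 0" using le[of 0] init by simp
      then show ?thesis using False init by (simp add: ext_init_def tau_def sigma_def)
    qed
  next
    case (Suc k)
    show ?case
    proof (cases "s (Suc k) \<omega> \<in> \<Lambda>")
      case True
      then show ?thesis
        using obs[OF True] cyc_1[OF assms(1)] by (simp add: Suc ext_step_def)
    next
      case False
      have "cyc T (int (cyc T (int k + 1 - tau t \<tau>0 k \<omega>)) + 1)
          = cyc T (int (Suc k) + 1 - tau t \<tau>0 k \<omega>)"
        unfolding cyc_cyc_add_1[OF assms(1)] by (simp add: algebra_simps)
      then show ?thesis
        using no_obs[OF False] False by (simp add: Suc ext_step_def)
    qed
  qed
qed

theorem theoremV2:
  fixes N M T :: nat
    and A :: "nat \<Rightarrow> real ^ 'n ^ 'n" and B :: "nat \<Rightarrow> real ^ 'm ^ 'n"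
    and p q :: "nat \<Rightarrow> nat \<Rightarrow> real"
    and \<Lambda> :: "nat set"
    and \<Omega> :: "'w measure" and r s :: "nat \<Rightarrow> nat \<Rightarrow> 'w \<Rightarrow> nat"
    and \<Omega>' :: "'v measure" and \<theta> :: "ext_state \<Rightarrow> nat \<Rightarrow> 'v \<Rightarrow> ext_state"
    and Kbar :: "ext_state \<Rightarrow> real ^ 'n ^ 'm"
    and K :: "nat \<Rightarrow> nat \<Rightarrow> real ^ 'n ^ 'm"
  assumes "N > 0" "M > 0" "T > 0"
    and "prob_space \<Omega>"
    and "\<And>r0. r0 \<in> {1..N} \<Longrightarrow> markov_chain \<Omega> {1..N} p r0 (r r0)"
    and "\<And>s0. s0 \<in> {1..M} \<Longrightarrow> markov_chain \<Omega> {1..M} q s0 (s s0)"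
    and "\<And>r0 s0. r0 \<in> {1..N} \<Longrightarrow> s0 \<in> {1..M} \<Longrightarrow>
           indep_processes \<Omega> {1..N} (r r0) {1..M} (s s0)"
    and "\<Lambda> \<subseteq> {1..M}" "\<Lambda> \<noteq> {}" "recurrent_set \<Omega> M s \<Lambda>"
    and "prob_space \<Omega>'"
    and "\<And>\<theta>0. \<theta>0 \<in> ext_states N M T \<Longrightarrow>
           markov_chain \<Omega>' (ext_states N M T) (ext_prob T \<Lambda> p q) \<theta>0 (\<theta> \<theta>0)"
    and "stabilizes_mjls \<Omega>' (ext_states N M T)
           (\<lambda>(\<alpha>, \<beta>, \<gamma>, \<delta>). A \<alpha>) (\<lambda>(\<alpha>, \<beta>, \<gamma>, \<delta>). B \<alpha>) \<theta> Kbar"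
    and "\<And>\<alpha> \<alpha>' \<beta> \<beta>' \<gamma> \<delta>.
           \<alpha> \<in> {1..N} \<Longrightarrow> \<alpha>' \<in> {1..N} \<Longrightarrow> \<beta> \<in> {1..M} \<Longrightarrow> \<beta>' \<in> {1..M} \<Longrightarrow>
           \<gamma> \<in> {1..N} \<Longrightarrow> \<delta> \<in> {1..T} \<Longrightarrow> Kbar (\<alpha>, \<beta>, \<gamma>, \<delta>) = Kbar (\<alpha>', \<beta>', \<gamma>, \<delta>)"
    and "\<And>\<gamma> \<delta>. \<gamma> \<in> {1..N} \<Longrightarrow> \<delta> \<in> {1..T} \<Longrightarrow> K \<gamma> \<delta> = Kbar (1, 1, \<gamma>, \<delta>)"
  shows "stabilizes_obs \<Omega> N A B r (obs_family M \<Lambda> s) T K"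
proof -
  interpret \<Omega>: prob_space \<Omega> by fact
  interpret \<Omega>': prob_space \<Omega>' by fact
  let ?S = "ext_states N M T"
  define G where "G \<xi> = (case \<xi> of (\<alpha>, \<beta>, \<gamma>, \<delta>) \<Rightarrow> A \<alpha>) + (case \<xi> of (\<alpha>, \<beta>, \<gamma>, \<delta>) \<Rightarrow> B \<alpha>) ** Kbar \<xi>"
    for \<xi>
  obtain C \<epsilon> where C: "C > 0" "0 \<le> \<epsilon>" "\<epsilon> < 1"
    and bound: "\<And>k x0 \<theta>0. \<theta>0 \<in> ?S \<Longrightarrow>
      second_moment \<Omega>' (solution (\<lambda>k \<omega>. G (\<theta> \<theta>0 k \<omega>)) x0 k)
        \<le> ennreal (C * \<epsilon> ^ k * (norm x0)\<^sup>2)"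
    using assms(13) unfolding stabilizes_mjls_def G_def by blast
  have "second_moment \<Omega> (solution (closed_loop A B (r r0) T K t \<tau>0 \<sigma>0) x0 k)
      \<le> ennreal (C * \<epsilon> ^ k * (norm x0)\<^sup>2)"
    if r0: "r0 \<in> {1..N}" and \<sigma>0: "\<sigma>0 \<in> {1..N}" and t: "t \<in> obs_family M \<Lambda> s"
    for k x0 r0 \<tau>0 \<sigma>0 t
  proof -
    obtain s0 where s0: "s0 \<in> {1..M}" and t_eq: "t = obs_process \<Lambda> (s s0)"
      using t by (auto simp: obs_family_def)
    define \<xi>0 where "\<xi>0 = ext_init T \<Lambda> r0 s0 \<tau>0 \<sigma>0"
    let ?Y = "ext_process T \<Lambda> \<xi>0 (r r0) (s s0)"
    have \<xi>0: "\<xi>0 \<in> ?S"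
      unfolding \<xi>0_def using assms(3) r0 s0 \<sigma>0 by (rule ext_init_mem)
    have \<xi>0_fst: "fst \<xi>0 = r0" "fst (snd \<xi>0) = s0"
      by (simp_all add: \<xi>0_def ext_init_def)
    note rchain = assms(5)[OF r0] and schain = assms(6)[OF s0]
    have rm: "\<And>i. r r0 i \<in> measurable \<Omega> (count_space {1..N})"
      and sm: "\<And>i. s s0 i \<in> measurable \<Omega> (count_space {1..M})"
      and ae: "AE \<omega> in \<Omega>. r r0 0 \<omega> = r0" "AE \<omega> in \<Omega>. s s0 0 \<omega> = s0"
      using rchain schain by (auto simp: markov_chain_def)
    have \<theta>m: "\<And>i. \<theta> \<xi>0 i \<in> measurable \<Omega>' (count_space ?S)"
      using assms(12)[OF \<xi>0] by (auto simp: markov_chain_def)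
    have Ym: "\<And>i. ?Y i \<in> measurable \<Omega> (count_space ?S)"
      by (rule ext_process_measurable[OF assms(3) \<xi>0 rm sm])
    have "AE \<omega> in \<Omega>. infinite {k. s s0 k \<omega> \<in> \<Lambda>}"
      using assms(10) s0 by (simp add: recurrent_set_def)
    with ae AE_space have "AE \<omega> in \<Omega>.
        solution (closed_loop A B (r r0) T K t \<tau>0 \<sigma>0) x0 k \<omega>
          = solution (\<lambda>k \<omega>. G (?Y k \<omega>)) x0 k \<omega>"
    proof eventually_elim
      case (elim \<omega>)
      have "closed_loop A B (r r0) T K t \<tau>0 \<sigma>0 j \<omega> = G (?Y j \<omega>)" for j
      proof -
        let ?\<gamma> = "sigma (r r0) t \<sigma>0 j \<omega>" and ?\<delta> = "cyc T (int j + 1 - tau t \<tau>0 j \<omega>)"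
        have Y: "?Y j \<omega> = (r r0 j \<omega>, s s0 j \<omega>, ?\<gamma>, ?\<delta>)"
          unfolding \<xi>0_def t_eq by (rule ext_process_eq) (use assms(3) elim in auto)
        have "?Y j \<omega> \<in> ?S"
          using measurable_space[OF Ym elim(3)] by simp
        then have mem: "r r0 j \<omega> \<in> {1..N}" "s s0 j \<omega> \<in> {1..M}" "?\<gamma> \<in> {1..N}" "?\<delta> \<in> {1..T}"
          unfolding Y by (auto simp: ext_states_def)
        have "K ?\<gamma> ?\<delta> = Kbar (1, 1, ?\<gamma>, ?\<delta>)" using assms(15) mem by blast
        also have "\<dots> = Kbar (?Y j \<omega>)"
          unfolding Y by (rule assms(14)) (use mem assms(1,2) in auto)
        finally show ?thesis by (simp add: closed_loop_def G_def Y)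
      qed
      then show ?case by (intro solution_cong)
    qed
    then have "second_moment \<Omega> (solution (closed_loop A B (r r0) T K t \<tau>0 \<sigma>0) x0 k)
        = second_moment \<Omega> (solution (\<lambda>k \<omega>. G (?Y k \<omega>)) x0 k)"
      unfolding second_moment_def by (intro nn_integral_cong_AE) (auto elim: eventually_mono)
    also have "\<dots> = second_moment \<Omega>' (solution (\<lambda>k \<omega>. G (\<theta> \<xi>0 k \<omega>)) x0 k)"
    proof -
      have "\<P>(\<omega> in \<Omega>. \<forall>i\<le>k. ?Y i \<omega> = c i) = \<P>(\<omega> in \<Omega>'. \<forall>i\<le>k. \<theta> \<xi>0 i \<omega> = c i)"
        if "c \<in> PiE {..k} (\<lambda>_. ?S)" for c
      proof -
        have c: "\<forall>i\<le>k. c i \<in> ?S" using that by auto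
        show ?thesis
          unfolding markov_chain_path_prob[OF assms(11) assms(12)[OF \<xi>0] c]
          by (rule ext_process_path_prob[OF assms(4) assms(3) \<xi>0 _ _ _ c])
            (use rchain schain assms(7)[OF r0 s0] in \<open>simp_all add: \<xi>0_fst\<close>)
      qed
      then show ?thesis
        unfolding second_moment_sum_paths[where G=G, OF finite_ext_states Ym]
          second_moment_sum_paths[where G=G, OF finite_ext_states \<theta>m]
        by (intro sum.cong refl)
          (simp add: \<Omega>.emeasure_eq_measure \<Omega>'.emeasure_eq_measure)
    qed
    also have "\<dots> \<le> ennreal (C * \<epsilon> ^ k * (norm x0)\<^sup>2)" by (rule bound[OF \<xi>0])
    finally show ?thesis .
  qed
  then show ?thesis
    unfolding stabilizes_obs_def using C by (intro exI[of _ C] exI[of _ \<epsilon>]) simp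
qed

end
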